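(* Let $m\ge1$, let $\mathcal{G}$ be either $\mathbb{Z}^m$ or a dense subset of $\mathbb{R}^m$, and let $f\in\mathcal{G}AA(\mathbb{R}^m,\mathbb{R})$ be bounded. If $u:\mathbb{R}^m\to\mathbb{R}$ is a bounded continuous function which is a solution in the sense of distributions of Poisson's equation $$\Delta u=f,$$ then $u\in\mathcal{K}AA(\mathbb{R}^m,\mathbb{R})$.
   Context: For a non-empty set $\mathcal{G}\subset\mathbb{R}^m$, a continuous function $f:\mathbb{R}^m\to\mathbb{R}$ belongs to $\mathcal{G}AA(\mathbb{R}^m,\mathbb{R})$ ($f$ is $\mathcal{G}$-multi-almost automorphic) if for every sequence $(\mathbf{b}_k)$ of elements of $\mathcal{G}$ there exist a subsequence $(\mathbf{b}_{k_l})$ and a function $f^*:\mathbb{R}^m\to\mathbb{R}$ such that, for every $\mathbf{t}\in\mathbb{R}^m$, $\lim_{l}f(\mathbf{t}+\mathbf{b}_{k_l})=f^*(\mathbf{t})$ and $\lim_{l}f^*(\mathbf{t}-\mathbf{b}_{k_l})=f(\mathbf{t})$. $\mathcal{K}AA(\mathbb{R}^m,\mathbb{R})$ is the space of compact almost automorphic functions: continuous $u:\mathbb{R}^m\to\mathbb{R}$ such that for every sequence $(\mathbf{b}_k)$ in $\mathbb{R}^m$ there exist a subsequence $(\mathbf{b}_{k_l})$ and a function $u^*:\mathbb{R}^m\to\mathbb{R}$ with $u(\cdot+\mathbf{b}_{k_l})\to u^*$ and $u^*(\cdot-\mathbf{b}_{k_l})\to u$ uniformly on compact subsets of $\mathbb{R}^m$.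 For $f$ bounded and continuous, $u$ is a solution in the sense of distributions of $\Delta u=f$ if $\int_{\mathbb{R}^m}u(x)\Delta\phi(x)\,dx=\int_{\mathbb{R}^m}f(x)\phi(x)\,dx$ for all $\phi\in C_0^\infty(\mathbb{R}^m)$ (smooth functions with compact support). *)

theory Defs
  imports "HOL-Analysis.Analysis"
begin

definition multi_almost_automorphic ::
    "(real ^ 'm) set \<Rightarrow> (real ^ 'm \<Rightarrow> real) \<Rightarrow> bool" where
  "multi_almost_automorphic G f \<longleftrightarrow>
     continuous_on UNIV f \<and>
     (\<forall>b :: nat \<Rightarrow> real ^ 'm. range b \<subseteq> G \<longrightarrow>
       (\<exists>(r :: nat \<Rightarrow> nat) (g :: real ^ 'm \<Rightarrow> real). strict_mono r \<and>
         (\<forall>t. (\<lambda>l. f (t + b (r l))) \<longlonglongrightarrow> g t) \<and>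
         (\<forall>t. (\<lambda>l. g (t - b (r l))) \<longlonglongrightarrow> f t)))"

definition compact_almost_automorphic :: "(real ^ 'm \<Rightarrow> real) \<Rightarrow> bool" where
  "compact_almost_automorphic u \<longleftrightarrow>
     continuous_on UNIV u \<and>
     (\<forall>b :: nat \<Rightarrow> real ^ 'm.
       (\<exists>(r :: nat \<Rightarrow> nat) (v :: real ^ 'm \<Rightarrow> real). strict_mono r \<and>
         (\<forall>K. compact K \<longrightarrow>
           uniform_limit K (\<lambda>l t. u (t + b (r l))) v sequentially) \<and>
         (\<forall>K. compact K \<longrightarrow>
           uniform_limit K (\<lambda>l t. v (t - b (r l))) u sequentially)))"

definition integer_lattice :: "(real ^ 'm) set" where
  "integer_lattice = {x. \<forall>i. x $ i \<in> \<int>}"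

definition directional_deriv ::
    "real ^ 'm \<Rightarrow> (real ^ 'm \<Rightarrow> real) \<Rightarrow> real ^ 'm \<Rightarrow> real" where
  "directional_deriv v \<phi> x = frechet_derivative \<phi> (at x) v"

primrec Ck :: "nat \<Rightarrow> (real ^ 'm \<Rightarrow> real) \<Rightarrow> bool" where
  "Ck 0 \<phi> \<longleftrightarrow> continuous_on UNIV \<phi>"
| "Ck (Suc k) \<phi> \<longleftrightarrow>
     (\<forall>x. \<phi> differentiable (at x)) \<and> (\<forall>v. Ck k (directional_deriv v \<phi>))"

definition test_function :: "(real ^ 'm \<Rightarrow> real) \<Rightarrow> bool" where
  "test_function \<phi> \<longleftrightarrow> (\<forall>k. Ck k \<phi>) \<and> compact (closure {x. \<phi> x \<noteq> 0})"

definition laplacian :: "(real ^ 'm \<Rightarrow> real) \<Rightarrow> real ^ 'm \<Rightarrow> real" where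
  "laplacian \<phi> x =
     (\<Sum>i\<in>UNIV. directional_deriv (axis i 1) (directional_deriv (axis i 1) \<phi>) x)"

text \<open>Meant for continuous \<open>u\<close> and \<open>f\<close>: then both integrands are continuous with compact
  support, so the convention that the Bochner integral of a non-integrable function is \<open>0\<close>
  plays no role.\<close>

definition distributional_poisson_solution ::
    "(real ^ 'm \<Rightarrow> real) \<Rightarrow> (real ^ 'm \<Rightarrow> real) \<Rightarrow> bool" where
  "distributional_poisson_solution u f \<longleftrightarrow>
     (\<forall>\<phi>. test_function \<phi> \<longrightarrow>
       (\<integral>x. u x * laplacian \<phi> x \<partial>lborel) = (\<integral>x. f x * \<phi> x \<partial>lborel))"

end

theory Submission
  imports Defs "HOL-Complex_Analysis.Great_Picard"
begin

text \<open>
  The whole argument rests on one estimate.  For a smooth radial kernel \<open>k\<close> with support in the unit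
  ball, consider the averages \<open>A r x\<close>, the integral of \<open>u (x + r w) * k w\<close> over \<open>w\<close>.  The vector field
  \<open>w * k w\<close> is the gradient of a smooth function with compact support, and therefore the derivative
  of \<open>A\<close> with respect to \<open>r\<close> is the integral of \<open>u\<close> against the Laplacian of a test function
  (\<open>DERIV_bump_radius\<close>).  By the equation it is \<open>r / 2\<close> times a weighted integral of \<open>f\<close>
  (\<open>DERIV_bump_average\<close>).  Hence \<open>A r x\<close> differs from a fixed multiple of \<open>u x\<close> by at most a constant
  times \<open>sup \<bar>f\<bar> * r\<^sup>2\<close>, whereas \<open>A r x\<close> is uniformly continuous in \<open>x\<close> with a modulus that depends
  only on \<open>sup \<bar>u\<bar>\<close> and on the distance divided by \<open>r\<close> (\<open>poisson_oscillation\<close>).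

  Small radii give uniform continuity of \<open>u\<close> (\<open>poisson_uniformly_continuous\<close>).  Large radii, in the
  case \<open>f = 0\<close>, give Liouville's theorem for bounded continuous functions that are harmonic in the
  sense of distributions (\<open>bounded_harmonic_constant\<close>).

  Now let \<open>g\<close> be a sequence in \<open>G\<close>.  Translates of \<open>u\<close> are uniformly equicontinuous, so along a
  subsequence \<open>u (t + g k)\<close> tends to some \<open>v t\<close> and \<open>v (t - g k)\<close> to some \<open>w t\<close>.  The right-hand sides follow along, and as \<open>f\<close> returns to itself, \<open>w\<close> and \<open>u\<close> solve the same equation.
  They differ by a constant, and the constant is \<open>0\<close> since passing to limits of translates can
  neither raise the supremum nor lower the infimum (\<open>poisson_translates_return\<close>).  Finally, an
  arbitrary sequence differs from a sequence in \<open>G\<close> by a bounded one, whose convergent subsequences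
  are absorbed by uniform continuity, and equicontinuity turns pointwise convergence into uniform
  convergence on compact sets (\<open>poisson_compact_almost_automorphic\<close>).
\<close>

section \<open>A stock of smooth functions with compact support\<close>

text \<open>
  The powers in the denominator make the family closed under differentiation up to linear
  combinations, so that smoothness follows by induction without a formula for higher derivatives.
\<close>

definition flat :: "nat \<Rightarrow> real \<Rightarrow> real" where
  "flat n t = (if t > 0 then exp (- 1 / t) / t ^ n else 0)"

definition flat_deriv :: "nat \<Rightarrow> real \<Rightarrow> real" where
  "flat_deriv n t = flat (n + 2) t - real n * flat (n + 1) t"

lemma flat_nonneg: "0 \<le> flat n t"
  by (simp add: flat_def)

text \<open>
  With \<open>s = 1 / t\<close> this is the decay of \<open>s ^ n / exp s\<close> at infinity.
\<close>

lemma flat_tendsto_0: "(flat n \<longlongrightarrow> 0) (at 0)"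
proof -
  have "((\<lambda>t::real. inverse t ^ n / exp (inverse t)) \<longlongrightarrow> 0) (at_right 0)"
    by (rule filterlim_compose[OF tendsto_power_div_exp_0 filterlim_inverse_at_top_right])
  then have R: "(flat n \<longlongrightarrow> 0) (at_right 0)"
    by (rule Lim_transform_eventually)
       (auto simp: flat_def eventually_at_filter exp_minus field_simps intro!: always_eventually)
  have "(flat n \<longlongrightarrow> 0) (at_left 0)"
    by (rule Lim_transform_eventually[OF tendsto_const])
       (auto simp: flat_def eventually_at_filter)
  with R show ?thesis by (simp add: filterlim_at_split)
qed

text \<open>
  The only delicate point is \<open>0\<close>: there the difference quotient of \<open>flat n\<close> is
  \<open>flat (n + 1)\<close>, which tends to \<open>0\<close>.
\<close>

lemma DERIV_flat: "(flat n has_real_derivative flat_deriv n t) (at t)"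
proof (cases t "0::real" rule: linorder_cases)
  case less
  have "((\<lambda>_. 0::real) has_real_derivative 0) (at t)" by simp
  then have "(flat n has_real_derivative 0) (at t)"
    by (rule has_field_derivative_transform_within_open[of _ _ _ "{..<0}"])
       (use less in \<open>auto simp: flat_def\<close>)
  with less show ?thesis by (simp add: flat_deriv_def flat_def)
next
  case equal
  have "((\<lambda>h. (flat n (0 + h) - flat n 0) / h) \<longlongrightarrow> 0) (at 0)"
    by (rule Lim_transform_eventually[OF flat_tendsto_0[of "Suc n"]])
       (auto simp: flat_def)
  then have "(flat n has_real_derivative 0) (at 0)"
    by (simp add: DERIV_def)
  with equal show ?thesis by (simp add: flat_deriv_def flat_def)
next
  case greater
  have "real n * t ^ (n - 1) = real n * t ^ n / t"
    using greater by (cases n) auto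
  then have "((\<lambda>t. exp (- 1 / t) / t ^ n) has_real_derivative flat_deriv n t) (at t)"
    using greater
    by (auto intro!: derivative_eq_intros simp: flat_deriv_def flat_def)
       (simp add: field_simps power2_eq_square)
  then show ?thesis
    by (rule has_field_derivative_transform_within_open[of _ _ _ "{0<..}"])
       (use greater in \<open>auto simp: flat_def\<close>)
qed

lemma has_derivative_flat [derivative_intros]:
  assumes "(g has_derivative g') (at x within S)"
  shows "((\<lambda>x. flat n (g x)) has_derivative (\<lambda>v. flat_deriv n (g x) * g' v)) (at x within S)"
  using has_derivative_compose[OF assms, of "flat n" "(*) (flat_deriv n (g x))"] DERIV_flat[of n "g x"]
  by (simp add: has_field_derivative_def)

lemma DERIV_flat_chain [derivative_intros]:
  assumes "(g has_real_derivative g') (at x within S)"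
  shows "((\<lambda>x. flat n (g x)) has_real_derivative flat_deriv n (g x) * g') (at x within S)"
  by (rule DERIV_chain2[OF DERIV_flat assms])

lemma continuous_on_flat [continuous_intros]:
  assumes "continuous_on S g"
  shows "continuous_on S (\<lambda>x. flat n (g x))"
  by (rule continuous_on_compose2[OF _ assms, of UNIV])
     (auto intro: DERIV_continuous_on DERIV_flat)

lemma continuous_on_flat_deriv [continuous_intros]:
  "continuous_on S g \<Longrightarrow> continuous_on S (\<lambda>x. flat_deriv n (g x))"
  unfolding flat_deriv_def by (intro continuous_intros)

text \<open>
  A class of functions that contains the coordinates and is closed under partial derivatives:
  each of its members is then smooth in the sense of \<open>Ck\<close>.
\<close>

inductive flat_expr :: "(real ^ 'm \<Rightarrow> real) \<Rightarrow> bool" where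
  linear: "bounded_linear l \<Longrightarrow> flat_expr l"
| const: "flat_expr (\<lambda>_. c)"
| add: "flat_expr p \<Longrightarrow> flat_expr q \<Longrightarrow> flat_expr (\<lambda>x. p x + q x)"
| mult: "flat_expr p \<Longrightarrow> flat_expr q \<Longrightarrow> flat_expr (\<lambda>x. p x * q x)"
| flat: "flat_expr p \<Longrightarrow> flat_expr (\<lambda>x. flat n (p x))"

lemma flat_expr_sum: "(\<And>i. i \<in> I \<Longrightarrow> flat_expr (p i)) \<Longrightarrow> flat_expr (\<lambda>x. \<Sum>i\<in>I. p i x)"
  by (induction I rule: infinite_finite_induct) (auto intro: flat_expr.intros)

lemma flat_expr_derivative:
  "flat_expr p \<Longrightarrow> \<exists>D. (\<forall>v. flat_expr (\<lambda>x. D x v)) \<and> (\<forall>x. (p has_derivative D x) (at x))"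
proof (induction rule: flat_expr.induct)
  case (linear l)
  then show ?case
    by (intro exI[of _ "\<lambda>_. l"]) (auto intro: flat_expr.const bounded_linear_imp_has_derivative)
next
  case (const c)
  then show ?case by (intro exI[of _ "\<lambda>_ _. 0"]) (auto intro: flat_expr.const)
next
  case (add p q)
  then obtain D E where "\<And>v. flat_expr (\<lambda>x. D x v)" "\<And>x. (p has_derivative D x) (at x)"
     "\<And>v. flat_expr (\<lambda>x. E x v)" "\<And>x. (q has_derivative E x) (at x)" by metis
  then show ?case
    by (intro exI[of _ "\<lambda>x v. D x v + E x v"]) (auto intro: flat_expr.intros has_derivative_add)
next
  case (mult p q)
  then obtain D E where "\<And>v. flat_expr (\<lambda>x. D x v)" "\<And>x. (p has_derivative D x) (at x)"
     "\<And>v. flat_expr (\<lambda>x. E x v)" "\<And>x. (q has_derivative E x) (at x)" by metis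
  with mult.hyps show ?case
    by (intro exI[of _ "\<lambda>x v. p x * E x v + D x v * q x"])
       (auto intro!: flat_expr.add flat_expr.mult has_derivative_mult)
next
  case (flat p n)
  then obtain D where D: "\<And>v. flat_expr (\<lambda>x. D x v)" "\<And>x. (p has_derivative D x) (at x)" by metis
  have eq: "flat_deriv n y = flat (n + 2) y + (- real n) * flat (n + 1) y" for y
    by (simp add: flat_deriv_def)
  have "flat_expr (\<lambda>x. flat_deriv n (p x) * D x v)" for v
    unfolding eq using D flat.hyps
    by (intro flat_expr.mult flat_expr.add flat_expr.flat flat_expr.const) auto
  with D show ?case
    by (intro exI[of _ "\<lambda>x v. flat_deriv n (p x) * D x v"]) (auto intro: has_derivative_flat)
qed

lemma directional_deriv_eq:
  "(\<phi> has_derivative D) (at x) \<Longrightarrow> directional_deriv v \<phi> x = D v"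
  by (simp add: directional_deriv_def frechet_derivative_at[symmetric])

lemma flat_expr_Ck: "flat_expr p \<Longrightarrow> Ck k p"
proof (induction k arbitrary: p)
  case 0
  then obtain D where "\<And>x. (p has_derivative D x) (at x)"
    using flat_expr_derivative by blast
  then show ?case
    by (auto intro!: continuous_at_imp_continuous_on has_derivative_continuous)
next
  case (Suc k)
  then obtain D where D: "\<And>v. flat_expr (\<lambda>x. D x v)" "\<And>x. (p has_derivative D x) (at x)"
    using flat_expr_derivative by blast
  then have "directional_deriv v p = (\<lambda>x. D x v)" for v
    by (auto simp: fun_eq_iff directional_deriv_eq)
  with D Suc.IH show ?case by (auto simp: differentiable_def)
qed

text \<open>
  The radial profiles used below.  The gradient of \<open>bump 0 x r\<close> at \<open>z\<close> is
  \<open>- 2 / r\<^sup>2 * bump 2 x r z\<close> times \<open>z - x\<close>, so \<open>bump 2\<close> will serve as an averaging kernel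
  and \<open>bump 0\<close> as the test function that controls it.
\<close>

definition bump :: "nat \<Rightarrow> real ^ 'm \<Rightarrow> real \<Rightarrow> real ^ 'm \<Rightarrow> real" where
  "bump n x r z = flat n (1 - ((z - x) \<bullet> (z - x)) / r\<^sup>2)"

lemma bump_nonneg: "0 \<le> bump n x r z"
  by (simp add: bump_def flat_nonneg)

lemma bump_rescale: "r > 0 \<Longrightarrow> bump n x r (x + r *\<^sub>R w) = bump n 0 1 w"
  by (simp add: bump_def power2_eq_square)

lemma bump_eq_0: "r > 0 \<Longrightarrow> z \<notin> cball x r \<Longrightarrow> bump n x r z = 0"
  using power_strict_mono[of r "norm (z - x)" 2]
  by (simp add: bump_def flat_def dist_norm norm_minus_commute[of z] dot_square_norm)

lemma continuous_on_bump [continuous_intros]: 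
  "continuous_on S g \<Longrightarrow> continuous_on S (\<lambda>y. bump n x r (g y))"
  unfolding bump_def divide_inverse by (intro continuous_intros)

lemma test_function_bump:
  assumes "r > 0"
  shows "test_function (bump n x r :: real ^ 'm \<Rightarrow> real)"
proof -
  have eq: "bump n x r = (\<lambda>z. flat n (1 + (- 1 / r\<^sup>2) * (\<Sum>i\<in>UNIV. (z $ i + - x $ i) * (z $ i + - x $ i))))"
    by (simp add: bump_def fun_eq_iff inner_vec_def)
  have "flat_expr (bump n x r)"
    unfolding eq by (intro flat_expr.flat flat_expr.add flat_expr.mult flat_expr_sum flat_expr.const
         flat_expr.linear bounded_linear_vec_nth)
  moreover have "closure {z. bump n x r z \<noteq> 0} \<subseteq> cball x r"
    using bump_eq_0[OF assms, of _ x n] by (intro closure_minimal) (blast, simp)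
  then have "compact (closure {z. bump n x r z \<noteq> 0})"
    using bounded_subset[OF bounded_cball] by (auto simp: compact_eq_bounded_closed)
  ultimately show ?thesis by (simp add: test_function_def flat_expr_Ck)
qed

lemma laplacian_bump:
  fixes x :: "real ^ 'm"
  assumes "r > 0"
  shows "laplacian (bump 0 x r) z =
    4 * ((z - x) \<bullet> (z - x)) / r ^ 4 * flat_deriv 2 (1 - ((z - x) \<bullet> (z - x)) / r\<^sup>2)
    - 2 * real CARD('m) / r\<^sup>2 * bump 2 x r z"
proof -
  let ?h = "\<lambda>z. 1 - ((z - x) \<bullet> (z - x)) / r\<^sup>2"
  have h: "(?h has_derivative (\<lambda>v. - 2 * ((z - x) \<bullet> v) / r\<^sup>2)) (at z)" for z
    by (auto intro!: derivative_eq_intros simp: inner_commute divide_inverse algebra_simps)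
  have d1: "directional_deriv (axis i 1) (bump 0 x r) = (\<lambda>z. flat 2 (?h z) * (- 2 * ((z - x) \<bullet> axis i 1) / r\<^sup>2))" for i
    unfolding bump_def
    by (rule ext, subst directional_deriv_eq[OF has_derivative_flat[OF h]])
       (simp add: flat_deriv_def numeral_2_eq_2)
  have d2: "directional_deriv (axis i 1) (directional_deriv (axis i 1) (bump 0 x r)) z =
     4 / r^4 * flat_deriv 2 (?h z) * (z $ i - x $ i)\<^sup>2 - 2 / r\<^sup>2 * flat 2 (?h z)" for i
  proof -
    have "((\<lambda>z. flat 2 (?h z) * (- 2 * ((z - x) \<bullet> axis i 1) / r\<^sup>2)) has_derivative 
       (\<lambda>v. flat 2 (?h z) * (- 2 * (v \<bullet> axis i 1) / r\<^sup>2) + 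
         flat_deriv 2 (?h z) * (- 2 * ((z - x) \<bullet> v) / r\<^sup>2) * (- 2 * ((z - x) \<bullet> axis i 1) / r\<^sup>2))) (at z)"
      by (rule has_derivative_mult[OF has_derivative_flat[OF h]])
         (use assms in \<open>auto intro!: derivative_eq_intros simp: divide_inverse\<close>)
    then show ?thesis unfolding d1
      using assms by (subst directional_deriv_eq) (auto simp: inner_axis power2_eq_square power4_eq_xxxx field_simps)
  qed
  show ?thesis
    unfolding laplacian_def d2 sum_subtractf sum_distrib_left[symmetric]
    by (simp add: inner_vec_def power2_eq_square bump_def mult_ac)
qed

section \<open>Integrals against bounded functions\<close>

lemma lborel_integral_affine:
  fixes g :: "'a::euclidean_space \<Rightarrow> real"
  assumes [measurable]: "g \<in> borel_measurable borel" and "r > 0"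
  shows "(\<integral>z. g z \<partial>lborel) = r ^ DIM('a) * (\<integral>w. g (x + r *\<^sub>R w) \<partial>lborel)"
proof -
  have "(\<integral>z. g z \<partial>lborel) = (\<integral>z. g z \<partial>density (distr lborel borel (\<lambda>w. x + r *\<^sub>R w)) (\<lambda>_. ennreal (\<bar>r\<bar> ^ DIM('a))))"
    using lborel_affine[of r x] \<open>r > 0\<close> by (simp add: ennreal_power)
  also have "\<dots> = (\<integral>w. r ^ DIM('a) * g (x + r *\<^sub>R w) \<partial>lborel)"
    using \<open>r > 0\<close> by (subst integral_density; (subst integral_distr)?) auto
  finally show ?thesis by simp
qed

lemma lborel_integral_shift:
  fixes g :: "'a::euclidean_space \<Rightarrow> real"
  assumes "g \<in> borel_measurable borel"
  shows "(\<integral>w. g (w + x) \<partial>lborel) = (\<integral>z. g z \<partial>lborel)"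
  using lborel_integral_affine[OF assms, of 1 x] by (simp add: add.commute)

lemma integrable_compact_support:
  fixes \<phi> :: "'a::euclidean_space \<Rightarrow> real"
  assumes "compact K" "continuous_on UNIV \<phi>" "\<And>x. x \<notin> K \<Longrightarrow> \<phi> x = 0"
  shows "integrable lborel \<phi>"
proof -
  have "(\<lambda>x. indicator K x *\<^sub>R \<phi> x) = \<phi>"
    using assms(3) by (force simp: indicator_def fun_eq_iff)
  with borel_integrable_compact[of K \<phi>] assms show ?thesis
    by (metis continuous_on_subset subset_UNIV)
qed

lemma integrable_bounded_mult:
  fixes \<phi> g :: "'a \<Rightarrow> real"
  assumes "integrable M \<phi>" "g \<in> borel_measurable M" "\<And>x. \<bar>g x\<bar> \<le> N"
  shows "integrable M (\<lambda>x. g x * \<phi> x)"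
proof (rule Bochner_Integration.integrable_bound)
  show "integrable M (\<lambda>x. N * \<bar>\<phi> x\<bar>)" using assms by simp
  show "(\<lambda>x. g x * \<phi> x) \<in> borel_measurable M" using assms by measurable
  show "AE x in M. norm (g x * \<phi> x) \<le> norm (N * \<bar>\<phi> x\<bar>)"
    using assms(3) by (auto simp: abs_mult intro!: mult_right_mono order_trans[OF assms(3)])
qed

lemma integral_bounded_mult_le:
  fixes \<phi> g :: "'a \<Rightarrow> real"
  assumes "integrable M \<phi>" "g \<in> borel_measurable M" "\<And>x. \<bar>g x\<bar> \<le> N"
  shows "\<bar>\<integral>x. g x * \<phi> x \<partial>M\<bar> \<le> N * (\<integral>x. \<bar>\<phi> x\<bar> \<partial>M)"
proof -
  have "\<bar>\<integral>x. g x * \<phi> x \<partial>M\<bar> \<le> (\<integral>x. \<bar>g x * \<phi> x\<bar> \<partial>M)"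
    by (rule integral_abs_bound)
  also have "\<dots> \<le> (\<integral>x. N * \<bar>\<phi> x\<bar> \<partial>M)"
    using assms by (intro integral_mono integrable_abs integrable_bounded_mult[OF assms])
                   (auto simp: abs_mult intro!: mult_right_mono)
  finally show ?thesis by simp
qed

text \<open>
  Dominated convergence in the form in which a distributional equation passes to pointwise
  limits of uniformly bounded functions.
\<close>

lemma integral_bounded_mult_tendsto:
  fixes \<phi> :: "'a \<Rightarrow> real" and g :: "nat \<Rightarrow> 'a \<Rightarrow> real"
  assumes "integrable M \<phi>" "\<And>k. g k \<in> borel_measurable M" "\<And>k x. \<bar>g k x\<bar> \<le> N"
    and lim: "\<And>x. (\<lambda>k. g k x) \<longlonglongrightarrow> h x"
  shows "(\<lambda>k. \<integral>x. g k x * \<phi> x \<partial>M) \<longlonglongrightarrow> (\<integral>x. h x * \<phi> x \<partial>M)"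
proof (rule integral_dominated_convergence[where w = "\<lambda>x. N * \<bar>\<phi> x\<bar>"])
  have [measurable]: "h \<in> borel_measurable M"
    by (rule borel_measurable_LIMSEQ_real[OF lim assms(2)])
  show "(\<lambda>x. h x * \<phi> x) \<in> borel_measurable M" using assms(1) by measurable
  show "integrable M (\<lambda>x. N * \<bar>\<phi> x\<bar>)" using assms by simp
  show "AE x in M. (\<lambda>k. g k x * \<phi> x) \<longlonglongrightarrow> h x * \<phi> x"
    using lim by (auto intro!: tendsto_intros)
  show "AE x in M. norm (g k x * \<phi> x) \<le> N * \<bar>\<phi> x\<bar>" for k
    using assms(3) by (auto simp: abs_mult intro!: mult_right_mono)
  show "(\<lambda>x. g k x * \<phi> x) \<in> borel_measurable M" for k
    using assms(1,2) by measurable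
qed

lemma test_function_integrable:
  assumes "test_function (\<phi> :: real ^ 'm \<Rightarrow> real)"
  shows "integrable lborel \<phi>"
proof (rule integrable_compact_support)
  have "Ck 0 \<phi>" using assms unfolding test_function_def by blast
  then show "continuous_on UNIV \<phi>" by simp
  show "compact (closure {x. \<phi> x \<noteq> 0})" using assms by (simp add: test_function_def)
  show "\<And>x. x \<notin> closure {x. \<phi> x \<noteq> 0} \<Longrightarrow> \<phi> x = 0" using closure_subset[of "{x. \<phi> x \<noteq> 0}"] by auto
qed

lemma directional_deriv_zero_on_open:
  assumes "open S" "\<And>x. x \<in> S \<Longrightarrow> \<phi> x = 0" "x \<in> S"
  shows "directional_deriv v \<phi> x = 0"
proof -
  have "((\<lambda>_. 0::real) has_derivative (\<lambda>_. 0)) (at x)" by simp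
  then have "(\<phi> has_derivative (\<lambda>_. 0)) (at x)"
    by (rule has_derivative_transform_within_open[OF _ assms(1,3)]) (simp add: assms(2))
  then show ?thesis by (rule directional_deriv_eq)
qed

lemma laplacian_zero_outside_support:
  assumes "x \<notin> closure {x. \<phi> x \<noteq> 0}"
  shows "laplacian \<phi> x = 0"
proof -
  let ?S = "- closure {x. \<phi> x \<noteq> 0}"
  have S: "open ?S" by (simp add: open_Compl)
  have 0: "\<phi> y = 0" if "y \<in> ?S" for y
    using that closure_subset[of "{x. \<phi> x \<noteq> 0}"] by auto
  have 1: "directional_deriv v \<phi> y = 0" if "y \<in> ?S" for v y
    by (rule directional_deriv_zero_on_open[OF S 0 that])
  have "directional_deriv v (directional_deriv w \<phi>) x = 0" for v w
    by (rule directional_deriv_zero_on_open[OF S 1]) (use assms in auto)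
  then show ?thesis by (simp add: laplacian_def)
qed

lemma continuous_on_laplacian:
  assumes "test_function \<phi>"
  shows "continuous_on UNIV (laplacian \<phi>)"
proof -
  have "Ck (Suc (Suc 0)) \<phi>" using assms unfolding test_function_def by blast
  then have "\<And>v w. continuous_on UNIV (directional_deriv v (directional_deriv w \<phi>))" by simp
  then show ?thesis unfolding laplacian_def[abs_def] by (intro continuous_on_sum)
qed

lemma laplacian_integrable:
  assumes "test_function \<phi>"
  shows "integrable lborel (laplacian \<phi>)"
proof (rule integrable_compact_support)
  show "compact (closure {x. \<phi> x \<noteq> 0})" using assms by (simp add: test_function_def)
  show "continuous_on UNIV (laplacian \<phi>)" using assms by (rule continuous_on_laplacian)
  show "\<And>x. x \<notin> closure {x. \<phi> x \<noteq> 0} \<Longrightarrow> laplacian \<phi> x = 0"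
    by (rule laplacian_zero_outside_support)
qed

lemma integrable_bump: "r > 0 \<Longrightarrow> integrable lborel (bump n x r)"
  by (rule test_function_integrable[OF test_function_bump])

section \<open>Averages of a solution over bumps\<close>

text \<open>
  A weighted mean of \<open>u\<close> over the ball of radius \<open>r\<close> around \<open>x\<close>, up to the factor
  \<open>bump_mass 2\<close>.  Integrating over the unit ball keeps the definition meaningful at \<open>r = 0\<close>,
  where it gives a multiple of \<open>u x\<close>.
\<close>

definition bump_average :: "(real ^ 'm \<Rightarrow> real) \<Rightarrow> real ^ 'm \<Rightarrow> real \<Rightarrow> real" where
  "bump_average u x r = (\<integral>w. u (x + r *\<^sub>R w) * bump 2 0 1 w \<partial>lborel)"

lemma integral_bump_rescale:
  fixes g :: "real ^ 'm \<Rightarrow> real"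
  assumes [measurable]: "g \<in> borel_measurable borel" and "r > 0"
  shows "(\<integral>z. g z * bump n x r z \<partial>lborel) =
    r ^ CARD('m) * (\<integral>w. g (x + r *\<^sub>R w) * bump n 0 1 w \<partial>lborel)"
proof -
  have [measurable]: "bump n x r \<in> borel_measurable borel"
    using continuous_on_bump[OF continuous_on_id, of UNIV n x r]
    by (rule borel_measurable_continuous_onI)
  have "(\<lambda>z. g z * bump n x r z) \<in> borel_measurable borel" by measurable
  from lborel_integral_affine[OF this \<open>r > 0\<close>, of x] show ?thesis
    by (simp add: bump_rescale \<open>r > 0\<close>)
qed

lemma integral_cbox_eq_lborel:
  fixes F :: "'a::euclidean_space \<Rightarrow> real"
  assumes "continuous_on UNIV F" "\<And>z. z \<notin> cbox a b \<Longrightarrow> F z = 0"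
  shows "integral (cbox a b) F = (\<integral>z. F z \<partial>lborel)"
proof -
  have "F integrable_on cbox a b"
    using assms(1) by (intro integrable_continuous) (auto intro: continuous_on_subset)
  then have "(F has_integral integral (cbox a b) F) UNIV"
    using assms(2) has_integral_on_superset[of F _ "cbox a b" UNIV] by blast
  moreover have "integrable lborel F"
    using assms by (intro integrable_compact_support[of "cbox a b"]) auto
  ultimately show ?thesis
    using has_integral_integral_lborel has_integral_unique by blast
qed

text \<open>
  The identity behind the mean value property.  The kernel \<open>K r z = r ^ (- m) * k ((z - x) / r)\<close>
  satisfies \<open>\<partial>K/\<partial>r = - div ((z - x) K) / r\<close> by scaling, and \<open>(z - x) K\<close> is the gradient of a
  multiple of \<open>bump 0 x r\<close>; hence the radial derivative of the kernel is the Laplacian of a test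
  function.
\<close>

lemma DERIV_bump_radius:
  fixes x z :: "real ^ 'm"
  assumes "r > 0"
  shows "((\<lambda>r. bump 2 x r z / r ^ CARD('m)) has_real_derivative
           r / (2 * r ^ CARD('m)) * laplacian (bump 0 x r) z) (at r within S)"
proof -
  let ?m = "CARD('m)"
  define q P A B where "q = (z - x) \<bullet> (z - x)" and "P = r ^ ?m"
    and "A = flat 2 (1 - q / r\<^sup>2)" and "B = flat_deriv 2 (1 - q / r\<^sup>2)"
  have P: "P > 0" using assms by (simp add: P_def)
  have dP: "((\<lambda>r. r ^ ?m) has_real_derivative real ?m * P / r) (at r within S)"
    by (rule DERIV_cong[OF DERIV_power[OF DERIV_ident]])
       (use assms in \<open>cases ?m; simp add: P_def\<close>)
  have "((\<lambda>r. 1 - q / r\<^sup>2) has_real_derivative 2 * q / r ^ 3) (at r within S)"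
    using assms by (auto intro!: derivative_eq_intros simp: field_simps eval_nat_numeral)
  then have dA: "((\<lambda>r. flat 2 (1 - q / r\<^sup>2)) has_real_derivative B * (2 * q / r ^ 3)) (at r within S)"
    unfolding B_def by (rule DERIV_flat_chain)
  have "((\<lambda>r. flat 2 (1 - q / r\<^sup>2) / r ^ ?m) has_real_derivative
     (B * (2 * q / r ^ 3) * P - A * (real ?m * P / r)) / (P * P)) (at r within S)"
    using DERIV_divide[OF dA dP] assms by (simp add: A_def P_def)
  then have "((\<lambda>r. flat 2 (1 - q / r\<^sup>2) / r ^ ?m) has_real_derivative
     r / (2 * P) * (4 * q / r ^ 4 * B - 2 * real ?m / r\<^sup>2 * A)) (at r within S)"
    by (rule DERIV_cong) (use assms P in \<open>simp add: field_simps eval_nat_numeral\<close>)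
  then show ?thesis
    unfolding laplacian_bump[OF assms] bump_def q_def P_def A_def B_def .
qed

text \<open>
  Since the radial derivative of the kernel is the Laplacian of a test function, the equation
  moves that Laplacian from \<open>u\<close> to \<open>f\<close>, and only the bounded quantity \<open>f\<close> is left.
\<close>

lemma DERIV_bump_average:
  fixes u f :: "real ^ 'm \<Rightarrow> real"
  assumes u: "continuous_on UNIV u" and f: "f \<in> borel_measurable borel"
    and sol: "distributional_poisson_solution u f" and r: "r > 0"
  shows "(bump_average u x has_real_derivative
      r / 2 * (\<integral>w. f (x + r *\<^sub>R w) * bump 0 0 1 w \<partial>lborel)) (at r)"
proof -
  let ?m = "CARD('m)"
  let ?U = "{r / 2 <..< 2 * r}"
  \<comment> \<open>Differentiation under the integral sign needs one box that contains the supports for all radii near \<open>r\<close>.\<close>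
  obtain a b where ab: "cball x (2 * r) \<subseteq> cbox a b"
    using bounded_subset_cbox_symmetric[OF bounded_cball[of x "2 * r"]] by metis
  define F where "F s z = u z * (bump 2 x s z / s ^ ?m)" for s z
  define F' where "F' s z = u z * (s / (2 * s ^ ?m) * laplacian (bump 0 x s) z)" for s z
  have pos: "0 < s" "cball x s \<subseteq> cball x (2 * r)" if "s \<in> ?U" for s
    using that r by auto
  have u_meas: "u \<in> borel_measurable borel" using u by (rule borel_measurable_continuous_onI)
  have off: "bump n x s z = 0" "laplacian (bump 0 x s) z = 0" if "s \<in> ?U" "z \<notin> cbox a b" for s z n
  proof -
    have z: "z \<notin> cball x s" using that ab pos(2)[OF that(1)] by blast
    show "bump n x s z = 0" using bump_eq_0 pos that z by blast
    have "closure {z. bump 0 x s z \<noteq> 0} \<subseteq> cball x s"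
      using bump_eq_0[OF pos(1)[OF that(1)], of _ x 0] by (intro closure_minimal) (blast, simp)
    with z show "laplacian (bump 0 x s) z = 0" by (intro laplacian_zero_outside_support) blast
  qed
  have contF: "continuous_on UNIV (F s)" if "s \<in> ?U" for s
    unfolding F_def using pos[OF that] u by (intro continuous_intros) auto
  have contF': "continuous_on UNIV (F' s)" if "s \<in> ?U" for s
    unfolding F'_def using pos[OF that] u
    by (intro continuous_intros continuous_on_laplacian test_function_bump) auto
  have avg: "integral (cbox a b) (F s) = bump_average u x s" if "s \<in> ?U" for s
  proof -
    have "integral (cbox a b) (F s) = (\<integral>z. F s z \<partial>lborel)"
      by (rule integral_cbox_eq_lborel[OF contF[OF that]]) (simp add: F_def off(1)[OF that])
    also have "\<dots> = (\<integral>z. u z * bump 2 x s z \<partial>lborel) / s ^ ?m"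
      by (simp add: F_def)
    also have "\<dots> = bump_average u x s"
      using integral_bump_rescale[OF u_meas pos(1)[OF that], of 2 x] pos(1)[OF that]
      by (simp add: bump_average_def)
    finally show ?thesis .
  qed
  have "((\<lambda>s. integral (cbox a b) (F s)) has_field_derivative integral (cbox a b) (F' r)) (at r within ?U)"
  proof (rule leibniz_rule_field_derivative)
    show "((\<lambda>s. F s z) has_field_derivative F' s z) (at s within ?U)" if "s \<in> ?U" for s z
      unfolding F_def F'_def by (intro DERIV_cmult DERIV_bump_radius pos that)
    show "F s integrable_on cbox a b" if "s \<in> ?U" for s
      using contF[OF that] by (intro integrable_continuous) (auto intro: continuous_on_subset)
    \<comment> \<open>Joint continuity in radius and point is visible only in the explicit formula for the Laplacian.\<close>
    have eq: "F' s z = u z * (s / (2 * s ^ ?m) *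
      (4 * ((z - x) \<bullet> (z - x)) / s ^ 4 * flat_deriv 2 (1 - ((z - x) \<bullet> (z - x)) / s\<^sup>2)
       - 2 * real ?m / s\<^sup>2 * flat 2 (1 - ((z - x) \<bullet> (z - x)) / s\<^sup>2)))" if "s \<in> ?U" for s z
      by (simp add: F'_def laplacian_bump[OF pos(1)[OF that]] bump_def)
    have cu: "continuous_on (?U \<times> cbox a b) (\<lambda>p. u (snd p))"
      by (intro continuous_on_compose2[OF u] continuous_on_snd continuous_on_id) simp
    show "continuous_on (?U \<times> cbox a b) (\<lambda>(s, z). F' s z)"
      unfolding case_prod_beta
      by (subst continuous_on_cong[OF refl eq])
         (use r in \<open>auto intro!: continuous_intros cu\<close>)
    show "r \<in> ?U" "convex ?U" using r by auto
  qed
  then have "((\<lambda>s. integral (cbox a b) (F s)) has_field_derivative integral (cbox a b) (F' r)) (at r)"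
    using r by (subst (asm) at_within_open) auto
  then have "(bump_average u x has_field_derivative integral (cbox a b) (F' r)) (at r)"
    by (rule has_field_derivative_transform_within_open[of _ _ _ ?U]) (use r avg in auto)
  moreover have "integral (cbox a b) (F' r) = r / 2 * (\<integral>w. f (x + r *\<^sub>R w) * bump 0 0 1 w \<partial>lborel)"
  proof -
    have rU: "r \<in> ?U" using r by auto
    have "integral (cbox a b) (F' r) = (\<integral>z. F' r z \<partial>lborel)"
      by (rule integral_cbox_eq_lborel[OF contF'[OF rU]]) (simp add: F'_def off(2)[OF rU])
    also have "\<dots> = (\<integral>z. r / (2 * r ^ ?m) * (u z * laplacian (bump 0 x r) z) \<partial>lborel)"
      unfolding F'_def by (intro Bochner_Integration.integral_cong) auto
    also have "\<dots> = r / (2 * r ^ ?m) * (\<integral>z. u z * laplacian (bump 0 x r) z \<partial>lborel)"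
      by simp
    also have "(\<integral>z. u z * laplacian (bump 0 x r) z \<partial>lborel) = (\<integral>z. f z * bump 0 x r z \<partial>lborel)"
      using sol test_function_bump[OF r] unfolding distributional_poisson_solution_def by blast
    also have "\<dots> = r ^ ?m * (\<integral>w. f (x + r *\<^sub>R w) * bump 0 0 1 w \<partial>lborel)"
      by (rule integral_bump_rescale[OF f r])
    finally show ?thesis using r by simp
  qed
  ultimately show ?thesis by simp
qed

abbreviation bump_mass :: "nat \<Rightarrow> (real ^ 'm) itself \<Rightarrow> real" where
  "bump_mass n _ \<equiv> \<integral>w. bump n (0 :: real ^ 'm) 1 w \<partial>lborel"

text \<open>
  The \<open>L\<^sup>1\<close> modulus of continuity of the averaging kernel.
\<close>

definition bump_shift_distance :: "real ^ 'm \<Rightarrow> real" where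
  "bump_shift_distance d = (\<integral>w. \<bar>bump 2 0 1 w - bump 2 d 1 w\<bar> \<partial>lborel)"

lemma bump_mass_pos: "bump_mass n TYPE(real ^ 'm) > 0"
proof (rule ccontr)
  assume "\<not> ?thesis"
  moreover have "bump_mass n TYPE(real ^ 'm) \<ge> 0"
    by (intro integral_nonneg_AE) (auto simp: bump_nonneg)
  ultimately have "bump_mass n TYPE(real ^ 'm) = 0" by linarith
  then have AE: "AE w in lborel. bump n (0 :: real ^ 'm) 1 w = 0"
    by (subst (asm) integral_nonneg_eq_0_iff_AE) (auto simp: bump_nonneg integrable_bump)
  have "bump n (0 :: real ^ 'm) 1 w > 0" if "w \<in> ball 0 1" for w
  proof -
    have "w \<bullet> w < 1" using that by (simp add: dot_square_norm power_less_one_iff)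
    then show ?thesis by (simp add: bump_def flat_def)
  qed
  then have "AE w in lborel. w \<notin> ball (0 :: real ^ 'm) 1"
    by (intro eventually_mono[OF AE]) force
  then have "ball (0 :: real ^ 'm) 1 \<in> null_sets lborel"
    by (subst (asm) AE_iff_null_sets[symmetric]) auto
  then have "negligible (ball (0 :: real ^ 'm) 1)"
    by (simp add: negligible_iff_null_sets null_sets_completionI)
  then show False using open_not_negligible[of "ball (0 :: real ^ 'm) 1"] by simp
qed

lemma continuous_on_bump_average:
  fixes u :: "real ^ 'm \<Rightarrow> real"
  assumes u: "continuous_on UNIV u" and M: "\<And>x. \<bar>u x\<bar> \<le> M"
  shows "continuous_on UNIV (bump_average u x)"
proof (rule continuous_on_sequentiallyI)
  fix s :: "nat \<Rightarrow> real" and r assume s: "s \<longlonglongrightarrow> r"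
  have "continuous_on UNIV (\<lambda>w. u (x + c *\<^sub>R w))" for c
    by (rule continuous_on_compose2[OF u]) (auto intro!: continuous_intros)
  then have "(\<lambda>w. u (x + c *\<^sub>R w)) \<in> borel_measurable lborel" for c
    by (simp add: borel_measurable_continuous_onI)
  moreover have "(\<lambda>k. u (x + s k *\<^sub>R w)) \<longlonglongrightarrow> u (x + r *\<^sub>R w)" for w
    by (rule continuous_on_tendsto_compose[OF u]) (auto intro!: tendsto_intros s)
  ultimately show "(\<lambda>k. bump_average u x (s k)) \<longlonglongrightarrow> bump_average u x r"
    unfolding bump_average_def
    by (intro integral_bounded_mult_tendsto[where N = M] integrable_bump M) auto
qed

text \<open>
  The derivative of the average with respect to the radius \<open>s\<close> is at most a multiple of
  \<open>N * s\<close>, and the average at radius \<open>0\<close> is a multiple of \<open>u x\<close>; the mean value theorem does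
  the rest.
\<close>

lemma bump_average_error:
  fixes u f :: "real ^ 'm \<Rightarrow> real"
  assumes u: "continuous_on UNIV u" and M: "\<And>x. \<bar>u x\<bar> \<le> M"
    and f: "f \<in> borel_measurable borel" and N: "\<And>x. \<bar>f x\<bar> \<le> N"
    and sol: "distributional_poisson_solution u f" and r: "r > 0"
  shows "\<bar>bump_average u x r - u x * bump_mass 2 TYPE(real ^ 'm)\<bar>
           \<le> N * bump_mass 0 TYPE(real ^ 'm) * r\<^sup>2"
proof -
  let ?V = "bump_mass 0 TYPE(real ^ 'm)"
  let ?D = "\<lambda>s. s / 2 * (\<integral>w. f (x + s *\<^sub>R w) * bump 0 0 1 w \<partial>lborel)"
  obtain s where s: "0 < s" "s < r"
    and eq: "bump_average u x r - bump_average u x 0 = ?D s * (r - 0)"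
  proof (rule mvt[of 0 r "bump_average u x" "\<lambda>s. (*) (?D s)"])
    show "continuous_on {0..r} (bump_average u x)"
      using continuous_on_bump_average[OF u M] by (rule continuous_on_subset) simp
    show "(bump_average u x has_derivative (*) (?D s)) (at s)" if "0 < s" for s
      using DERIV_bump_average[OF u f sol that] by (simp add: has_field_derivative_def)
  qed (use r in auto)
  have [measurable]: "f \<in> borel_measurable borel" by (rule f)
  have "\<bar>\<integral>w. f (x + s *\<^sub>R w) * bump 0 0 1 w \<partial>lborel\<bar> \<le> N * (\<integral>w. \<bar>bump 0 (0 :: real ^ 'm) 1 w\<bar> \<partial>lborel)"
    by (rule integral_bounded_mult_le[OF integrable_bump _ N]) auto
  then have "\<bar>?D s\<bar> \<le> s / 2 * (N * ?V)"
    using s by (simp add: abs_mult bump_nonneg mult_left_mono)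
  also have "\<dots> \<le> r * (N * ?V)"
  proof (rule mult_right_mono)
    have "0 \<le> N" using N[of 0] by linarith
    then show "0 \<le> N * ?V" using bump_mass_pos[of 0, where 'm = 'm] by simp
  qed (use s in simp)
  finally have "\<bar>r * ?D s\<bar> \<le> r * (r * (N * ?V))"
    using r by (simp only: abs_mult) (simp add: mult_left_mono)
  moreover have "bump_average u x 0 = u x * bump_mass 2 TYPE(real ^ 'm)"
    by (simp add: bump_average_def)
  ultimately show ?thesis using eq by (simp add: power2_eq_square mult_ac)
qed

text \<open>
  Moving the centre from \<open>x\<close> to \<open>y\<close> amounts to shifting the rescaled kernel by
  \<open>(y - x) / r\<close>, so the modulus of continuity comes from the kernel and not from \<open>u\<close>.
\<close>

lemma bump_average_translate:
  fixes u :: "real ^ 'm \<Rightarrow> real"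
  assumes u: "continuous_on UNIV u" and M: "\<And>x. \<bar>u x\<bar> \<le> M" and r: "r > 0"
  shows "\<bar>bump_average u x r - bump_average u y r\<bar> \<le> M * bump_shift_distance ((y - x) /\<^sub>R r)"
proof -
  define d where "d = (y - x) /\<^sub>R r"
  have y: "y + r *\<^sub>R w = x + r *\<^sub>R (w + d)" for w
    using r by (simp add: d_def algebra_simps)
  have u': "continuous_on UNIV (\<lambda>w. u (x + r *\<^sub>R w))"
    by (rule continuous_on_compose2[OF u]) (auto intro!: continuous_intros)
  have b: "bump 2 0 1 w = bump 2 d 1 (w + d)" for w by (simp add: bump_def)
  have "bump_average u y r = (\<integral>w. u (x + r *\<^sub>R (w + d)) * bump 2 d 1 (w + d) \<partial>lborel)"
    unfolding bump_average_def y by (subst b) simp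
  also have "\<dots> = (\<integral>w. u (x + r *\<^sub>R w) * bump 2 d 1 w \<partial>lborel)"
    by (rule lborel_integral_shift[where g = "\<lambda>w. u (x + r *\<^sub>R w) * bump 2 d 1 w"])
       (intro borel_measurable_continuous_onI continuous_on_mult u' continuous_on_bump continuous_on_id)
  finally have "bump_average u x r - bump_average u y r =
      (\<integral>w. u (x + r *\<^sub>R w) * bump 2 0 1 w - u (x + r *\<^sub>R w) * bump 2 d 1 w \<partial>lborel)"
    unfolding bump_average_def
    by (subst Bochner_Integration.integral_diff)
       (auto intro!: integrable_bounded_mult[where N = M] integrable_bump M
          borel_measurable_continuous_onI u')
  also have "\<dots> = (\<integral>w. u (x + r *\<^sub>R w) * (bump 2 0 1 w - bump 2 d 1 w) \<partial>lborel)"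
    by (simp add: right_diff_distrib)
  also have "\<bar>\<dots>\<bar> \<le> M * bump_shift_distance d"
    unfolding bump_shift_distance_def
    by (rule integral_bounded_mult_le)
       (auto intro!: integrable_bump M borel_measurable_continuous_onI u')
  finally show ?thesis by (simp add: d_def)
qed

lemma bump_shift_distance_tendsto_0: "(bump_shift_distance \<longlongrightarrow> 0) (at (0 :: real ^ 'm))"
proof -
  have "compact (bump 2 (0 :: real ^ 'm) 1 ` cball 0 1)"
    by (intro compact_continuous_image continuous_on_bump continuous_on_id compact_cball)
  then obtain B where B: "\<And>w. w \<in> cball 0 1 \<Longrightarrow> \<bar>bump 2 (0 :: real ^ 'm) 1 w\<bar> \<le> B"
    by (force dest!: compact_imp_bounded simp: bounded_iff)
  have "B \<ge> 0" using B[of 0] by simp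
  \<comment> \<open>A dominating function that works for all shifts of norm at most one.\<close>
  have bd: "bump 2 d 1 w \<le> B * indicator (cball 0 2) w" if "norm d \<le> 1" for d w :: "real ^ 'm"
  proof (cases "w \<in> cball d 1")
    case True
    then have "norm w \<le> 2" using that norm_triangle_ineq[of d "w - d"] by (simp add: dist_norm norm_minus_commute)
    moreover have "bump 2 d 1 w = bump 2 0 1 (w - d)" by (simp add: bump_def)
    moreover have "w - d \<in> cball 0 1" using True by (simp add: dist_norm norm_minus_commute)
    ultimately show ?thesis using B[of "w - d"] by simp
  next
    case False
    then show ?thesis using \<open>B \<ge> 0\<close> by (simp add: bump_eq_0)
  qed
  have "(bump_shift_distance \<longlongrightarrow> bump_shift_distance (0 :: real ^ 'm)) (at (0 :: real ^ 'm) within cball 0 1)"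
    unfolding tendsto_at_iff_sequentially o_def
  proof (intro allI impI)
    fix X :: "nat \<Rightarrow> real ^ 'm" assume X: "\<forall>i. X i \<in> cball 0 1 - {0}" "X \<longlonglongrightarrow> 0"
    show "(\<lambda>i. bump_shift_distance (X i)) \<longlonglongrightarrow> bump_shift_distance (0 :: real ^ 'm)"
      unfolding bump_shift_distance_def
    proof (rule integral_dominated_convergence[where w = "\<lambda>w :: real ^ 'm. 2 * B * indicator (cball 0 2) w"])
      show "integrable lborel (\<lambda>w. 2 * B * indicator (cball (0 :: real ^ 'm) 2) w)"
        by (intro integrable_mult_right integrable_real_indicator emeasure_lborel_cball_finite) auto
      have "continuous_on UNIV (\<lambda>d. bump 2 d 1 w)" for w :: "real ^ 'm"
        unfolding bump_def by (intro continuous_intros) auto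
      then have lim: "(\<lambda>i. bump 2 (X i) 1 w) \<longlonglongrightarrow> bump 2 0 1 w" for w
        by (rule continuous_on_tendsto_compose[OF _ X(2)]) auto
      show "AE w in lborel. (\<lambda>i. \<bar>bump 2 0 1 w - bump 2 (X i) 1 w\<bar>) \<longlonglongrightarrow> \<bar>bump 2 0 1 w - bump 2 0 1 w\<bar>"
        by (intro AE_I2 tendsto_intros lim)
      show "AE w in lborel. norm \<bar>bump 2 0 1 w - bump 2 (X i) 1 w\<bar> \<le> 2 * B * indicator (cball 0 2) w" for i
      proof (rule AE_I2)
        fix w :: "real ^ 'm"
        have "norm (X i) \<le> 1" using X(1) by (auto simp: dist_norm)
        then have b: "bump 2 (X i) 1 w \<le> B * indicator (cball 0 2) w"
          "bump 2 0 1 w \<le> B * indicator (cball 0 2) w" by (intro bd; simp)+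
        have "\<bar>a - b\<bar> \<le> 2 * C" if "0 \<le> a" "0 \<le> b" "a \<le> C" "b \<le> C" for a b C :: real
          using that by linarith
        from this[OF bump_nonneg bump_nonneg b(2,1)]
        show "norm \<bar>bump 2 0 1 w - bump 2 (X i) 1 w\<bar> \<le> 2 * B * indicator (cball 0 2) w"
          by (simp add: mult.assoc)
      qed
    qed (auto intro!: borel_measurable_continuous_onI continuous_intros)
  qed
  moreover have "at (0 :: real ^ 'm) within cball 0 1 = at 0"
    by (rule at_within_interior) (simp add: interior_cball)
  moreover have "bump_shift_distance (0 :: real ^ 'm) = 0"
    by (simp add: bump_shift_distance_def)
  ultimately show ?thesis by simp
qed

section \<open>Equicontinuity and the Liouville property\<close>

text \<open>
  Comparing \<open>u x\<close> and \<open>u y\<close> through their averages of radius \<open>r\<close>.  A small \<open>r\<close> makes the first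
  term small and yields uniform continuity; if \<open>N = 0\<close>, the first term vanishes and \<open>r\<close> may tend
  to infinity, which yields Liouville's theorem.
\<close>

lemma poisson_oscillation:
  fixes u f :: "real ^ 'm \<Rightarrow> real"
  assumes u: "continuous_on UNIV u" and M: "\<And>x. \<bar>u x\<bar> \<le> M"
    and f: "f \<in> borel_measurable borel" and N: "\<And>x. \<bar>f x\<bar> \<le> N"
    and sol: "distributional_poisson_solution u f" and r: "r > 0"
  shows "bump_mass 2 TYPE(real ^ 'm) * \<bar>u x - u y\<bar>
     \<le> 2 * N * bump_mass 0 TYPE(real ^ 'm) * r\<^sup>2 + M * bump_shift_distance ((y - x) /\<^sub>R r)"
proof -
  have "bump_mass 2 TYPE(real ^ 'm) * \<bar>u x - u y\<bar> = \<bar>u x * bump_mass 2 TYPE(real ^ 'm) - u y * bump_mass 2 TYPE(real ^ 'm)\<bar>"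
    using bump_mass_pos[of 2, where 'm = 'm]
    by (simp add: abs_mult left_diff_distrib[symmetric])
  then show ?thesis
    using bump_average_error[OF u M f N sol r, of x] bump_average_error[OF u M f N sol r, of y]
      bump_average_translate[OF u M r, of x y] by linarith
qed

lemma poisson_uniformly_continuous:
  fixes u f :: "real ^ 'm \<Rightarrow> real"
  assumes u: "continuous_on UNIV u" and M: "\<And>x. \<bar>u x\<bar> \<le> M"
    and f: "f \<in> borel_measurable borel" and N: "\<And>x. \<bar>f x\<bar> \<le> N"
    and sol: "distributional_poisson_solution u f"
  shows "uniformly_continuous_on UNIV u"
  unfolding uniformly_continuous_on_def
proof (intro allI impI)
  fix e :: real assume "e > 0"
  define Z where "Z = bump_mass 2 TYPE(real ^ 'm)"
  define C where "C = 2 * N * bump_mass 0 TYPE(real ^ 'm)"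
  have Z: "Z > 0" unfolding Z_def by (rule bump_mass_pos)
  have "((\<lambda>r. C * r\<^sup>2) \<longlongrightarrow> C * 0\<^sup>2) (at_right 0)" by (intro tendsto_intros)
  then have "eventually (\<lambda>r. C * r\<^sup>2 < Z * e / 2) (at_right 0)"
    using Z \<open>e > 0\<close> by (intro order_tendstoD(2)) auto
  \<comment> \<open>First the radius is chosen to control the term with \<open>f\<close>, then the distance of the points.\<close>
  then obtain r where r: "r > 0" "C * r\<^sup>2 < Z * e / 2"
    using eventually_happens'[OF trivial_limit_at_right_real eventually_conj[OF _ eventually_at_right_less]] by blast
  have "((\<lambda>d. M * bump_shift_distance d) \<longlongrightarrow> M * 0) (at (0 :: real ^ 'm))"
    by (intro tendsto_intros bump_shift_distance_tendsto_0)
  then have "eventually (\<lambda>d. M * bump_shift_distance d < Z * e / 2) (at (0 :: real ^ 'm))"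
    using Z \<open>e > 0\<close> by (intro order_tendstoD(2)) auto
  then obtain \<delta> where \<delta>: "\<delta> > 0" "\<And>d :: real ^ 'm. d \<noteq> 0 \<Longrightarrow> norm d < \<delta> \<Longrightarrow> M * bump_shift_distance d < Z * e / 2"
    by (auto simp: eventually_at dist_norm)
  have "dist (u y) (u x) < e" if "dist y x < \<delta> * r" for x y
  proof (cases "y = x")
    case False
    have "norm ((y - x) /\<^sub>R r) = inverse r * norm (y - x)"
      using r(1) by (simp only: norm_scaleR abs_inverse abs_of_pos)
    also have "\<dots> < \<delta>" using that r(1) by (simp add: dist_norm field_simps)
    finally have "norm ((y - x) /\<^sub>R r) < \<delta>" .
    with False r have "M * bump_shift_distance ((y - x) /\<^sub>R r) < Z * e / 2"
      by (intro \<delta>) auto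
    with poisson_oscillation[OF u M f N sol r(1), of x y] r(2)
    have "Z * \<bar>u x - u y\<bar> < Z * e" unfolding Z_def[symmetric] C_def[symmetric] by linarith
    then show ?thesis using Z by (simp add: dist_real_def abs_minus_commute)
  qed (use \<open>e > 0\<close> in simp)
  then show "\<exists>d>0. \<forall>x\<in>UNIV. \<forall>x'\<in>UNIV. dist x' x < d \<longrightarrow> dist (u x') (u x) < e"
    using \<delta>(1) r(1) by (intro exI[of _ "\<delta> * r"]) auto
qed

lemma bounded_harmonic_constant:
  fixes h :: "real ^ 'm \<Rightarrow> real"
  assumes h: "continuous_on UNIV h" and M: "\<And>x. \<bar>h x\<bar> \<le> M"
    and sol: "distributional_poisson_solution h (\<lambda>_. 0)"
  shows "h x = h y"
proof (rule ccontr)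
  assume ne: "h x \<noteq> h y"
  define Z where "Z = bump_mass 2 TYPE(real ^ 'm)"
  have Z: "Z > 0" unfolding Z_def by (rule bump_mass_pos)
  have "filterlim (\<lambda>n. (y - x) /\<^sub>R real (Suc n)) (at 0) sequentially"
  proof (rule filterlim_atI)
    show "(\<lambda>n. (y - x) /\<^sub>R real (Suc n)) \<longlonglongrightarrow> 0"
      using tendsto_scaleR[OF LIMSEQ_inverse_real_of_nat tendsto_const[of "y - x"]] by simp
  qed (use ne in auto)
  then have "(\<lambda>n. M * bump_shift_distance ((y - x) /\<^sub>R real (Suc n))) \<longlonglongrightarrow> M * 0"
    by (intro tendsto_intros filterlim_compose[OF bump_shift_distance_tendsto_0])
  moreover have "Z * \<bar>h x - h y\<bar> \<le> M * bump_shift_distance ((y - x) /\<^sub>R real (Suc n))" for n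
    using poisson_oscillation[OF h M _ _ sol, of 0 "real (Suc n)" x y] by (simp add: Z_def)
  ultimately have "Z * \<bar>h x - h y\<bar> \<le> M * 0"
    by (intro LIMSEQ_le_const) auto
  with Z ne show False by (simp add: mult_le_0_iff)
qed

section \<open>Translates, limits and differences of distributional solutions\<close>

lemma has_derivative_shift_arg:
  assumes "(\<phi> has_derivative D) (at (x - a))"
  shows "((\<lambda>x. \<phi> (x - a)) has_derivative D) (at (x :: 'a::real_normed_vector))"
proof -
  have "((\<lambda>x. x - a) has_derivative (\<lambda>v. v)) (at x)"
    by (auto intro!: derivative_eq_intros)
  from has_derivative_compose[OF this assms] show ?thesis .
qed

lemma directional_deriv_shift:
  assumes "\<And>x. \<phi> differentiable (at x)"
  shows "directional_deriv v (\<lambda>x. \<phi> (x - a)) = (\<lambda>x. directional_deriv v \<phi> (x - a))"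
proof
  fix x
  obtain D where D: "(\<phi> has_derivative D) (at (x - a))"
    using assms unfolding differentiable_def by blast
  show "directional_deriv v (\<lambda>x. \<phi> (x - a)) x = directional_deriv v \<phi> (x - a)"
    using directional_deriv_eq[OF D] directional_deriv_eq[OF has_derivative_shift_arg[OF D]] by simp
qed

lemma Ck_shift: "Ck k \<phi> \<Longrightarrow> Ck k (\<lambda>x. \<phi> (x - a))"
proof (induction k arbitrary: \<phi>)
  case 0
  then have "continuous_on UNIV \<phi>" by simp
  then show ?case by (auto intro!: continuous_on_compose2[of UNIV \<phi>] continuous_intros)
next
  case (Suc k)
  then have d: "\<And>x. \<phi> differentiable (at x)" and "\<And>v. Ck k (directional_deriv v \<phi>)" by auto
  with Suc.IH have "Ck k (directional_deriv v (\<lambda>x. \<phi> (x - a)))" for v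
    by (simp add: directional_deriv_shift)
  moreover have "(\<lambda>x. \<phi> (x - a)) differentiable (at x)" for x
    using d[of "x - a"] unfolding differentiable_def by (blast intro: has_derivative_shift_arg)
  ultimately show ?case by simp
qed

lemma test_function_shift:
  assumes "test_function \<phi>"
  shows "test_function (\<lambda>x. \<phi> (x - a))"
proof -
  have "{x. \<phi> (x - a) \<noteq> 0} = (+) a ` {x. \<phi> x \<noteq> 0}"
  proof (intro subset_antisym subsetI)
    fix x assume "x \<in> {x. \<phi> (x - a) \<noteq> 0}"
    then show "x \<in> (+) a ` {x. \<phi> x \<noteq> 0}" by (intro image_eqI[of _ _ "x - a"]) auto
  qed auto
  then have "closure {x. \<phi> (x - a) \<noteq> 0} = (+) a ` closure {x. \<phi> x \<noteq> 0}"
    by (simp add: closure_translation)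
  with assms show ?thesis
    by (auto simp: test_function_def Ck_shift intro: compact_translation)
qed

lemma laplacian_shift:
  assumes "test_function \<phi>"
  shows "laplacian (\<lambda>x. \<phi> (x - a)) x = laplacian \<phi> (x - a)"
proof -
  have "Ck (Suc (Suc 0)) \<phi>" using assms unfolding test_function_def by blast
  then have "\<And>x. \<phi> differentiable (at x)" "\<And>v x. directional_deriv v \<phi> differentiable (at x)" by simp_all
  then show ?thesis by (simp add: laplacian_def directional_deriv_shift)
qed

lemma distributional_poisson_solution_shift:
  fixes u f :: "real ^ 'm \<Rightarrow> real"
  assumes [measurable]: "u \<in> borel_measurable borel" "f \<in> borel_measurable borel"
    and sol: "distributional_poisson_solution u f"
  shows "distributional_poisson_solution (\<lambda>x. u (x + a)) (\<lambda>x. f (x + a))"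
  unfolding distributional_poisson_solution_def
proof (intro allI impI)
  fix \<phi> :: "real ^ 'm \<Rightarrow> real" assume \<phi>: "test_function \<phi>"
  let ?\<psi> = "\<lambda>x. \<phi> (x - a)"
  have \<psi>: "test_function ?\<psi>" by (rule test_function_shift[OF \<phi>])
  have [measurable]: "?\<psi> \<in> borel_measurable borel" "laplacian ?\<psi> \<in> borel_measurable borel"
    using borel_measurable_integrable[OF test_function_integrable[OF \<psi>]]
      borel_measurable_integrable[OF laplacian_integrable[OF \<psi>]] by simp_all
  have "(\<integral>x. u (x + a) * laplacian \<phi> x \<partial>lborel) = (\<integral>x. (\<lambda>z. u z * laplacian ?\<psi> z) (x + a) \<partial>lborel)"
    by (simp add: laplacian_shift[OF \<phi>])
  also have "\<dots> = (\<integral>z. u z * laplacian ?\<psi> z \<partial>lborel)"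
    by (rule lborel_integral_shift) measurable
  also have "\<dots> = (\<integral>z. f z * ?\<psi> z \<partial>lborel)"
    using sol \<psi> unfolding distributional_poisson_solution_def by blast
  also have "\<dots> = (\<integral>x. (\<lambda>z. f z * ?\<psi> z) (x + a) \<partial>lborel)"
    by (rule lborel_integral_shift[symmetric]) measurable
  finally show "(\<integral>x. u (x + a) * laplacian \<phi> x \<partial>lborel) = (\<integral>x. f (x + a) * \<phi> x \<partial>lborel)" by simp
qed

lemma distributional_poisson_solution_limit:
  fixes u f :: "nat \<Rightarrow> real ^ 'm \<Rightarrow> real"
  assumes "\<And>k. u k \<in> borel_measurable borel" "\<And>k x. \<bar>u k x\<bar> \<le> M" "\<And>x. (\<lambda>k. u k x) \<longlonglongrightarrow> v x"
    and "\<And>k. f k \<in> borel_measurable borel" "\<And>k x. \<bar>f k x\<bar> \<le> N" "\<And>x. (\<lambda>k. f k x) \<longlonglongrightarrow> h x"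
    and sol: "\<And>k. distributional_poisson_solution (u k) (f k)"
  shows "distributional_poisson_solution v h"
  unfolding distributional_poisson_solution_def
proof (intro allI impI)
  fix \<phi> :: "real ^ 'm \<Rightarrow> real" assume \<phi>: "test_function \<phi>"
  have "(\<lambda>k. \<integral>x. u k x * laplacian \<phi> x \<partial>lborel) \<longlonglongrightarrow> (\<integral>x. v x * laplacian \<phi> x \<partial>lborel)"
    by (rule integral_bounded_mult_tendsto[OF laplacian_integrable[OF \<phi>], where N = M]) (simp_all add: assms)
  moreover have "(\<lambda>k. \<integral>x. f k x * \<phi> x \<partial>lborel) \<longlonglongrightarrow> (\<integral>x. h x * \<phi> x \<partial>lborel)"
    by (rule integral_bounded_mult_tendsto[OF test_function_integrable[OF \<phi>], where N = N]) (simp_all add: assms)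
  moreover have "(\<integral>x. u k x * laplacian \<phi> x \<partial>lborel) = (\<integral>x. f k x * \<phi> x \<partial>lborel)" for k
    using sol \<phi> unfolding distributional_poisson_solution_def by blast
  ultimately show "(\<integral>x. v x * laplacian \<phi> x \<partial>lborel) = (\<integral>x. h x * \<phi> x \<partial>lborel)"
    by (simp add: LIMSEQ_unique)
qed

lemma distributional_poisson_solution_diff:
  fixes u v f :: "real ^ 'm \<Rightarrow> real"
  assumes "u \<in> borel_measurable borel" "\<And>x. \<bar>u x\<bar> \<le> M"
    and "v \<in> borel_measurable borel" "\<And>x. \<bar>v x\<bar> \<le> M'"
    and "distributional_poisson_solution u f" "distributional_poisson_solution v f"
  shows "distributional_poisson_solution (\<lambda>x. u x - v x) (\<lambda>_. 0)"
  unfolding distributional_poisson_solution_def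
proof (intro allI impI)
  fix \<phi> :: "real ^ 'm \<Rightarrow> real" assume \<phi>: "test_function \<phi>"
  have "integrable lborel (\<lambda>x. u x * laplacian \<phi> x)" "integrable lborel (\<lambda>x. v x * laplacian \<phi> x)"
    using integrable_bounded_mult[OF laplacian_integrable[OF \<phi>] _ assms(2)]
      integrable_bounded_mult[OF laplacian_integrable[OF \<phi>] _ assms(4)] assms(1,3) by simp_all
  moreover have "(\<integral>x. u x * laplacian \<phi> x \<partial>lborel) = (\<integral>x. v x * laplacian \<phi> x \<partial>lborel)"
    using assms(5,6) \<phi> unfolding distributional_poisson_solution_def by simp
  ultimately show "(\<integral>x. (u x - v x) * laplacian \<phi> x \<partial>lborel) = (\<integral>x. 0 * \<phi> x \<partial>lborel)"
    by (simp add: left_diff_distrib)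
qed

section \<open>Uniformly equicontinuous sequences on the whole space\<close>

definition uniformly_equicontinuous :: "(nat \<Rightarrow> 'a::metric_space \<Rightarrow> 'b::metric_space) \<Rightarrow> bool" where
  "uniformly_equicontinuous F \<longleftrightarrow>
     (\<forall>e>0. \<exists>d>0. \<forall>n x y. dist x y < d \<longrightarrow> dist (F n x) (F n y) < e)"

lemma uniformly_equicontinuousE:
  assumes "uniformly_equicontinuous F" "e > 0"
  obtains d where "d > 0" "\<And>n x y. dist x y < d \<Longrightarrow> dist (F n x) (F n y) < e"
  using assms unfolding uniformly_equicontinuous_def by blast

lemma uniformly_equicontinuous_translates:
  fixes u :: "'a::real_normed_vector \<Rightarrow> 'b::metric_space"
  assumes "uniformly_continuous_on UNIV u"
  shows "uniformly_equicontinuous (\<lambda>n t. u (t + c n))"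
  unfolding uniformly_equicontinuous_def
proof (intro allI impI)
  fix e :: real assume "e > 0"
  then obtain d where "d > 0" "\<And>x y. dist x y < d \<Longrightarrow> dist (u x) (u y) < e"
    using uniformly_continuous_onE[OF assms] by (metis UNIV_I)
  then show "\<exists>d>0. \<forall>n x y. dist x y < d \<longrightarrow> dist (u (x + c n)) (u (y + c n)) < e"
    by (intro exI[of _ d]) simp
qed

lemma uniformly_equicontinuous_limit:
  assumes "uniformly_equicontinuous F" and lim: "\<And>x. (\<lambda>n. F n x) \<longlonglongrightarrow> g x"
  shows "uniformly_continuous_on UNIV g"
  unfolding uniformly_continuous_on_def
proof (intro allI impI)
  fix e :: real assume "e > 0"
  then obtain d where d: "d > 0" "\<And>n x y. dist x y < d \<Longrightarrow> dist (F n x) (F n y) < e / 2"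
    using uniformly_equicontinuousE[OF assms(1), of "e / 2"] by auto
  have "dist (g y) (g x) < e" if "dist y x < d" for x y
  proof -
    have "(\<lambda>n. dist (F n y) (F n x)) \<longlonglongrightarrow> dist (g y) (g x)"
      by (intro tendsto_intros lim)
    then have "dist (g y) (g x) \<le> e / 2"
      using d(2)[OF that] by (intro LIMSEQ_le_const2) (auto intro: less_imp_le)
    with \<open>e > 0\<close> show ?thesis by simp
  qed
  then show "\<exists>d>0. \<forall>x\<in>UNIV. \<forall>x'\<in>UNIV. dist x' x < d \<longrightarrow> dist (g x') (g x) < e"
    using d(1) by blast
qed

lemma uniformly_equicontinuous_uniform_limit:
  assumes "uniformly_equicontinuous F" and lim: "\<And>x. (\<lambda>n. F n x) \<longlonglongrightarrow> g x" and "compact K"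
  shows "uniform_limit K F g sequentially"
  unfolding uniform_limit_iff
proof (intro allI impI)
  fix e :: real assume "e > 0"
  then have "e / 3 > 0" by simp
  from uniformly_equicontinuousE[OF assms(1) this] obtain d1
    where d1: "d1 > 0" "\<And>n x y. dist x y < d1 \<Longrightarrow> dist (F n x) (F n y) < e / 3" by blast
  have "uniformly_continuous_on UNIV g" by (rule uniformly_equicontinuous_limit[OF assms(1) lim])
  then obtain d2 where d2: "d2 > 0" "\<And>x y. dist x y < d2 \<Longrightarrow> dist (g x) (g y) < e / 3"
    using uniformly_continuous_onE[OF _ \<open>e / 3 > 0\<close>] by (metis UNIV_I)
  define d where "d = min d1 d2"
  have "d > 0" using d1(1) d2(1) by (simp add: d_def)
  \<comment> \<open>At the points of a finite net the convergence is simultaneous; equicontinuity carries it to the rest of \<open>K\<close>.\<close>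
  then obtain C where C: "finite C" "K \<subseteq> (\<Union>c\<in>C. ball c d)"
    using \<open>compact K\<close> compact_eq_totally_bounded[of K] by meson
  have "eventually (\<lambda>n. \<forall>c\<in>C. dist (F n c) (g c) < e / 3) sequentially"
    using C(1) by (intro eventually_ball_finite ballI tendstoD[OF lim \<open>e / 3 > 0\<close>])
  then show "eventually (\<lambda>n. \<forall>x\<in>K. dist (F n x) (g x) < e) sequentially"
  proof eventually_elim
    case (elim n)
    show ?case
    proof
      fix x assume "x \<in> K"
      then obtain c where c: "c \<in> C" "dist c x < d" using C(2) by auto
      have "dist (F n x) (F n c) < e / 3" "dist (F n c) (g c) < e / 3" "dist (g c) (g x) < e / 3"
        using d1(2)[of x c n] d2(2)[of c x] bspec[OF elim c(1)] c(2)
        by (simp_all add: d_def dist_commute)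
      then show "dist (F n x) (g x) < e"
        using dist_triangle[of "F n x" "g x" "F n c"] dist_triangle[of "F n c" "g x" "g c"] by linarith
    qed
  qed
qed

text \<open>
  The theorem of Arzela and Ascoli on a non-compact domain: a diagonal sequence converges on a
  countable dense set, and equicontinuity makes it a Cauchy sequence at all other points.
\<close>

lemma uniformly_equicontinuous_convergent_subsequence:
  fixes F :: "nat \<Rightarrow> 'a::euclidean_space \<Rightarrow> real"
  assumes "uniformly_equicontinuous F" and M: "\<And>n x. \<bar>F n x\<bar> \<le> M"
  obtains r :: "nat \<Rightarrow> nat" and g where "strict_mono r" "\<And>x. (\<lambda>n. F (r n) x) \<longlonglongrightarrow> g x"
proof -
  obtain S :: "'a set" where S: "countable S" "\<And>X. open X \<Longrightarrow> X \<noteq> {} \<Longrightarrow> \<exists>d\<in>S. d \<in> X"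
    using countable_dense_setE by metis
  obtain r :: "nat \<Rightarrow> nat" where r: "strict_mono r" "\<And>x. x \<in> S \<Longrightarrow> \<exists>l. (\<lambda>n. F (r n) x) \<longlonglongrightarrow> l"
    using function_convergent_subsequence[OF S(1), of F M] M by auto
  have "Cauchy (\<lambda>n. F (r n) x)" for x
  proof (rule metric_CauchyI)
    fix e :: real assume "e > 0"
    then have "e / 3 > 0" by simp
    from uniformly_equicontinuousE[OF assms(1) this] obtain d
      where d: "d > 0" "\<And>n x y. dist x y < d \<Longrightarrow> dist (F n x) (F n y) < e / 3" by blast
    obtain s where s: "s \<in> S" "dist x s < d" using S(2)[of "ball x d"] d(1) by auto
    have "Cauchy (\<lambda>n. F (r n) s)" using r(2)[OF s(1)] convergent_Cauchy convergent_def by blast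
    then obtain k where k: "\<And>m n. m \<ge> k \<Longrightarrow> n \<ge> k \<Longrightarrow> dist (F (r m) s) (F (r n) s) < e / 3"
      using metric_CauchyD[OF _ \<open>e / 3 > 0\<close>] by blast
    have "dist (F (r m) x) (F (r n) x) < e" if "m \<ge> k" "n \<ge> k" for m n
      using k[OF that] d(2)[OF s(2), of "r m"] d(2)[OF s(2), of "r n"] unfolding dist_real_def by linarith
    then show "\<exists>k. \<forall>m\<ge>k. \<forall>n\<ge>k. dist (F (r m) x) (F (r n) x) < e" by blast
  qed
  then have "\<exists>l. (\<lambda>n. F (r n) x) \<longlonglongrightarrow> l" for x
    using Cauchy_convergent convergent_def by blast
  then obtain g where "\<And>x. (\<lambda>n. F (r n) x) \<longlonglongrightarrow> g x" by metis
  with r(1) that show thesis by blast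
qed

section \<open>Compact almost automorphy of the solution\<close>

text \<open>
  Limits of translates do not exceed the supremum of \<open>u\<close>, so \<open>u + c\<close> has a supremum of at
  most \<open>Sup (range u)\<close>.
\<close>

lemma translate_limit_offset_nonpos:
  fixes u v w :: "'a::real_normed_vector \<Rightarrow> real"
  assumes bdd: "bdd_above (range u)"
    and v: "\<And>t. (\<lambda>l. u (t + g l)) \<longlonglongrightarrow> v t" and w: "\<And>t. (\<lambda>l. v (t - g l)) \<longlonglongrightarrow> w t"
    and offset: "\<And>t. w t = u t + c"
  shows "c \<le> 0"
proof -
  have u_le: "u t \<le> Sup (range u)" for t by (simp add: bdd cSUP_upper)
  then have "v t \<le> Sup (range u)" for t by (intro LIMSEQ_le_const2[OF v]) auto
  then have w_le: "w t \<le> Sup (range u)" for t by (intro LIMSEQ_le_const2[OF w]) auto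
  have "u t \<le> Sup (range u) - c" for t using offset[of t] w_le[of t] by linarith
  then have "Sup (range u) \<le> Sup (range u) - c" by (intro cSUP_least) auto
  then show ?thesis by simp
qed

text \<open>
  The one-sided bound, for \<open>u\<close> and for \<open>- u\<close>.
\<close>

lemma translate_limit_offset_zero:
  fixes u v w :: "'a::real_normed_vector \<Rightarrow> real"
  assumes M: "\<And>t. \<bar>u t\<bar> \<le> M"
    and v: "\<And>t. (\<lambda>l. u (t + g l)) \<longlonglongrightarrow> v t" and w: "\<And>t. (\<lambda>l. v (t - g l)) \<longlonglongrightarrow> w t"
    and offset: "\<And>t. w t = u t + c"
  shows "c = 0"
proof -
  have "c \<le> 0"
    using M by (intro translate_limit_offset_nonpos[OF _ v w offset] bdd_aboveI2[where M = M])
               (simp add: abs_le_iff)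
  moreover have "- c \<le> 0"
  proof (rule translate_limit_offset_nonpos)
    show "bdd_above (range (\<lambda>t. - u t))"
      using M by (intro bdd_aboveI2[where M = M]) (simp add: abs_le_iff)
    show "(\<lambda>l. - u (t + g l)) \<longlonglongrightarrow> - v t" for t by (intro tendsto_minus v)
    show "(\<lambda>l. - v (t - g l)) \<longlonglongrightarrow> - w t" for t by (intro tendsto_minus w)
    show "- w t = - u t + - c" for t by (simp add: offset)
  qed
  ultimately show ?thesis by simp
qed

text \<open>
  Equicontinuity provides limits \<open>v\<close> of the translates of \<open>u\<close> and \<open>w\<close> of the translates back of
  \<open>v\<close>.  Along the same sequence \<open>f\<close> goes to some \<open>f'\<close> and returns to \<open>f\<close>, so \<open>w\<close> solves the same
  equation as \<open>u\<close>.  By Liouville's theorem \<open>w - u\<close> is constant, and comparing suprema and infima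
  shows that the constant is \<open>0\<close>.
\<close>

lemma poisson_translates_return:
  fixes u f :: "real ^ 'm \<Rightarrow> real"
  assumes u: "continuous_on UNIV u" and M: "\<And>x. \<bar>u x\<bar> \<le> M" and N: "\<And>x. \<bar>f x\<bar> \<le> N"
    and sol: "distributional_poisson_solution u f"
    and f: "multi_almost_automorphic G f" and g: "range g \<subseteq> G"
  obtains r :: "nat \<Rightarrow> nat" and v where "strict_mono r" "uniformly_continuous_on UNIV v"
    "\<And>t. (\<lambda>l. u (t + g (r l))) \<longlonglongrightarrow> v t" "\<And>t. (\<lambda>l. v (t - g (r l))) \<longlonglongrightarrow> u t"
proof -
  have f_cont: "continuous_on UNIV f" using f by (simp add: multi_almost_automorphic_def)
  have meas: "u \<in> borel_measurable borel" "f \<in> borel_measurable borel"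
    using u f_cont by (auto intro: borel_measurable_continuous_onI)
  \<comment> \<open>The limit \<open>f'\<close> below is a pointwise limit of continuous functions, possibly discontinuous; only its measurability is available.\<close>
  have shift_meas: "(\<lambda>t. h (t + a)) \<in> borel_measurable borel"
    if "h \<in> borel_measurable borel" for h :: "real ^ 'm \<Rightarrow> real" and a
    using that by measurable
  have ucu: "uniformly_continuous_on UNIV u"
    by (rule poisson_uniformly_continuous[OF u M meas(2) N sol])
  obtain r1 :: "nat \<Rightarrow> nat" and f' where r1: "strict_mono r1"
    and f': "\<And>t. (\<lambda>l. f (t + g (r1 l))) \<longlonglongrightarrow> f' t" "\<And>t. (\<lambda>l. f' (t - g (r1 l))) \<longlonglongrightarrow> f t"
    using f g unfolding multi_almost_automorphic_def by blast
  obtain r2 :: "nat \<Rightarrow> nat" and v where r2: "strict_mono r2"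
    and v2: "\<And>t. (\<lambda>l. u (t + g (r1 (r2 l)))) \<longlonglongrightarrow> v t"
    using uniformly_equicontinuous_convergent_subsequence
        [OF uniformly_equicontinuous_translates[OF ucu, of "\<lambda>l. g (r1 l)"] M] by blast
  have ucv: "uniformly_continuous_on UNIV v"
    by (rule uniformly_equicontinuous_limit[OF uniformly_equicontinuous_translates[OF ucu] v2])
  have v_cont: "continuous_on UNIV v" by (rule uniformly_continuous_imp_continuous[OF ucv])
  have bound_limit: "\<bar>l\<bar> \<le> B" if "X \<longlonglongrightarrow> l" "\<And>n. \<bar>X n\<bar> \<le> B" for X :: "nat \<Rightarrow> real" and l B
    using that by (intro LIMSEQ_le_const2[OF tendsto_rabs[OF that(1)]]) auto
  have vM: "\<bar>v t\<bar> \<le> M" for t by (rule bound_limit[OF v2 M])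
  have f'N: "\<bar>f' t\<bar> \<le> N" for t by (rule bound_limit[OF f'(1) N])
  obtain r3 :: "nat \<Rightarrow> nat" and w where r3: "strict_mono r3"
    and w3: "\<And>t. (\<lambda>l. v (t + - g (r1 (r2 (r3 l))))) \<longlonglongrightarrow> w t"
    using uniformly_equicontinuous_convergent_subsequence
        [OF uniformly_equicontinuous_translates[OF ucv, of "\<lambda>l. - g (r1 (r2 l))"] vM] by blast
  define r where "r l = r1 (r2 (r3 l))" for l
  have r: "strict_mono r"
    using r1 r2 r3 by (simp add: r_def strict_mono_def)
  have ucw: "uniformly_continuous_on UNIV w"
    by (rule uniformly_equicontinuous_limit[OF uniformly_equicontinuous_translates[OF ucv] w3])
  have w_cont: "continuous_on UNIV w" by (rule uniformly_continuous_imp_continuous[OF ucw])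
  have wM: "\<bar>w t\<bar> \<le> M" for t by (rule bound_limit[OF w3 vM])
  have vlim: "(\<lambda>l. u (t + g (r l))) \<longlonglongrightarrow> v t" for t
    using LIMSEQ_subseq_LIMSEQ[OF v2 r3] by (simp add: r_def o_def)
  have wlim: "(\<lambda>l. v (t - g (r l))) \<longlonglongrightarrow> w t" for t
    using w3 by (simp add: r_def)
  have "strict_mono (\<lambda>l. r2 (r3 l))" using r2 r3 by (simp add: strict_mono_def)
  then have f'lim: "(\<lambda>l. f (t + g (r l))) \<longlonglongrightarrow> f' t" "(\<lambda>l. f' (t - g (r l))) \<longlonglongrightarrow> f t" for t
    using LIMSEQ_subseq_LIMSEQ[OF f'(1), of "\<lambda>l. r2 (r3 l)"]
      LIMSEQ_subseq_LIMSEQ[OF f'(2), of "\<lambda>l. r2 (r3 l)"] by (simp_all add: r_def o_def)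
  have f'_meas: "f' \<in> borel_measurable borel"
    by (rule borel_measurable_LIMSEQ_real[OF f'(1)]) (rule shift_meas[OF meas(2)])
  have v_meas: "v \<in> borel_measurable borel" by (rule borel_measurable_continuous_onI[OF v_cont])
  have w_meas: "w \<in> borel_measurable borel" by (rule borel_measurable_continuous_onI[OF w_cont])
  have v_sol: "distributional_poisson_solution v f'"
    by (rule distributional_poisson_solution_limit[OF shift_meas[OF meas(1)] M vlim
          shift_meas[OF meas(2)] N f'lim(1) distributional_poisson_solution_shift[OF meas sol]])
  have w_sol: "distributional_poisson_solution w f"
  proof (rule distributional_poisson_solution_limit)
    show "(\<lambda>t. v (t + - g (r l))) \<in> borel_measurable borel"
      "(\<lambda>t. f' (t + - g (r l))) \<in> borel_measurable borel" for l
      by (rule shift_meas[OF v_meas], rule shift_meas[OF f'_meas])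
    show "distributional_poisson_solution (\<lambda>t. v (t + - g (r l))) (\<lambda>t. f' (t + - g (r l)))" for l
      by (rule distributional_poisson_solution_shift[OF v_meas f'_meas v_sol])
  qed (use vM f'N wlim f'lim(2) in auto)
  have diff_sol: "distributional_poisson_solution (\<lambda>t. w t - u t) (\<lambda>_. 0)"
    by (rule distributional_poisson_solution_diff[OF w_meas wM meas(1) M w_sol sol])
  have "\<bar>w t - u t\<bar> \<le> 2 * M" for t using wM[of t] M[of t] by linarith
  then have "w t - u t = w 0 - u 0" for t
    by (rule bounded_harmonic_constant[OF continuous_on_diff[OF w_cont u] _ diff_sol])
  then have offset: "w t = u t + (w 0 - u 0)" for t by (simp add: algebra_simps)
  have "w 0 - u 0 = 0" by (rule translate_limit_offset_zero[OF M vlim wlim offset])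
  with offset have "w = u" by (intro ext) simp
  with that[OF r ucv vlim] wlim show thesis by simp
qed

text \<open>
  Adding a convergent perturbation to the translations only moves the limit by a fixed vector,
  because both functions are uniformly continuous.
\<close>

lemma translate_limits_perturb:
  fixes u v :: "'a::euclidean_space \<Rightarrow> real"
  assumes u: "uniformly_continuous_on UNIV u" and v: "uniformly_continuous_on UNIV v"
    and lim: "\<And>t. (\<lambda>l. u (t + g l)) \<longlonglongrightarrow> v t" "\<And>t. (\<lambda>l. v (t - g l)) \<longlonglongrightarrow> u t"
    and c: "c \<longlonglongrightarrow> a"
  shows "(\<lambda>l. u (t + (g l + c l))) \<longlonglongrightarrow> v (t + a)"
    and "(\<lambda>l. v (t - (g l + c l) + a)) \<longlonglongrightarrow> u t"
proof -
  have close: "(\<lambda>l. h (p l) - h (q l)) \<longlonglongrightarrow> 0"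
    if h: "uniformly_continuous_on UNIV h" and pq: "(\<lambda>l. p l - q l) \<longlonglongrightarrow> 0"
    for h :: "'a \<Rightarrow> real" and p q :: "nat \<Rightarrow> 'a"
  proof -
    have "(\<lambda>l. dist (p l) (q l)) \<longlonglongrightarrow> 0"
      using tendsto_norm_zero[OF pq] by (simp add: dist_norm)
    then have "(\<lambda>l. dist (h (p l)) (h (q l))) \<longlonglongrightarrow> 0"
      using h unfolding uniformly_continuous_on_sequentially by simp
    then show ?thesis by (simp add: dist_real_def tendsto_rabs_zero_iff)
  qed
  have ca: "(\<lambda>l. c l - a) \<longlonglongrightarrow> 0" using c by (simp add: LIM_zero)
  have ac: "(\<lambda>l. a - c l) \<longlonglongrightarrow> 0" using tendsto_diff[OF tendsto_const[of a] c] by simp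
  have "(\<lambda>l. u (t + (g l + c l)) - u (t + a + g l)) \<longlonglongrightarrow> 0"
    by (rule close[OF u]) (use ca in \<open>simp add: algebra_simps\<close>)
  from tendsto_add[OF this lim(1)[of "t + a"]]
  show "(\<lambda>l. u (t + (g l + c l))) \<longlonglongrightarrow> v (t + a)" by simp
  have "(\<lambda>l. v (t - (g l + c l) + a) - v (t - g l)) \<longlonglongrightarrow> 0"
    by (rule close[OF v]) (use ac in \<open>simp add: algebra_simps\<close>)
  from tendsto_add[OF this lim(2)[of t]]
  show "(\<lambda>l. v (t - (g l + c l) + a)) \<longlonglongrightarrow> u t" by simp
qed

text \<open>
  Each \<open>b k\<close> is an element of \<open>G\<close> plus a bounded remainder, and the remainders converge along a
  subsequence.  Approximation by \<open>G\<close> within a fixed distance \<open>R\<close> is the property that integer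
  lattices and dense sets share.
\<close>

lemma poisson_compact_almost_automorphic:
  fixes G :: "(real ^ 'm) set" and f u :: "real ^ 'm \<Rightarrow> real"
  assumes dense: "\<And>x. \<exists>g\<in>G. dist x g \<le> R"
    and f: "multi_almost_automorphic G f" and N: "\<And>x. \<bar>f x\<bar> \<le> N"
    and u: "continuous_on UNIV u" and M: "\<And>x. \<bar>u x\<bar> \<le> M"
    and sol: "distributional_poisson_solution u f"
  shows "compact_almost_automorphic u"
  unfolding compact_almost_automorphic_def
proof (intro conjI allI)
  show "continuous_on UNIV u" by (rule u)
  fix b :: "nat \<Rightarrow> real ^ 'm"
  have "\<forall>k. \<exists>y. y \<in> G \<and> dist (b k) y \<le> R" using dense by blast
  then obtain g where g: "\<And>k. g k \<in> G" "\<And>k. dist (b k) (g k) \<le> R"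
    using choice[of "\<lambda>k y. y \<in> G \<and> dist (b k) y \<le> R"] by blast
  have "b k - g k \<in> cball 0 R" for k using g(2)[of k] by (simp add: dist_norm norm_minus_commute)
  then obtain a q where q: "strict_mono (q :: nat \<Rightarrow> nat)" and "((\<lambda>k. b k - g k) \<circ> q) \<longlonglongrightarrow> a"
    using compact_cball[of "0 :: real ^ 'm" R] unfolding compact_def by meson
  then have a: "(\<lambda>l. b (q l) - g (q l)) \<longlonglongrightarrow> a" by (simp add: o_def)
  have "range (\<lambda>l. g (q l)) \<subseteq> G" using g(1) by auto
  from poisson_translates_return[OF u M N sol f this]
  obtain s v where s: "strict_mono (s :: nat \<Rightarrow> nat)" and v: "uniformly_continuous_on UNIV v"
    and lim: "\<And>t. (\<lambda>l. u (t + g (q (s l)))) \<longlonglongrightarrow> v t" "\<And>t. (\<lambda>l. v (t - g (q (s l)))) \<longlonglongrightarrow> u t"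
    by blast
  define r where "r l = q (s l)" for l
  have r: "strict_mono r" using q s by (simp add: r_def strict_mono_def)
  have c: "(\<lambda>l. b (r l) - g (r l)) \<longlonglongrightarrow> a"
    using LIMSEQ_subseq_LIMSEQ[OF a s] by (simp add: r_def o_def)
  have uc: "uniformly_continuous_on UNIV u"
  proof (rule poisson_uniformly_continuous[OF u M _ N sol])
    show "f \<in> borel_measurable borel"
      using f by (auto simp: multi_almost_automorphic_def intro: borel_measurable_continuous_onI)
  qed
  have lim': "(\<lambda>l. u (t + b (r l))) \<longlonglongrightarrow> v (t + a)" "(\<lambda>l. v (t + (a - b (r l)))) \<longlonglongrightarrow> u t" for t
    using translate_limits_perturb[OF uc v lim[folded r_def] c, of t]
    by (simp_all add: algebra_simps)
  have "uniform_limit K (\<lambda>l t. u (t + b (r l))) (\<lambda>t. v (t + a)) sequentially" if "compact K" for K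
    by (rule uniformly_equicontinuous_uniform_limit
        [OF uniformly_equicontinuous_translates[OF uc] lim'(1) that])
  moreover have "uniform_limit K (\<lambda>l t. v (t - b (r l) + a)) u sequentially" if "compact K" for K
    using uniformly_equicontinuous_uniform_limit
        [OF uniformly_equicontinuous_translates[OF v] lim'(2) that]
    by (simp add: algebra_simps)
  ultimately show "\<exists>r v. strict_mono r \<and>
      (\<forall>K. compact K \<longrightarrow> uniform_limit K (\<lambda>l t. u (t + b (r l))) v sequentially) \<and>
      (\<forall>K. compact K \<longrightarrow> uniform_limit K (\<lambda>l t. v (t - b (r l))) u sequentially)"
    using r by (intro exI[of _ r] exI[of _ "\<lambda>t. v (t + a)"]) simp
qed

lemma integer_lattice_relatively_dense:
  fixes x :: "real ^ 'm"
  shows "\<exists>g\<in>integer_lattice. dist x g \<le> real CARD('m)"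
proof
  let ?g = "(\<chi> i. of_int \<lfloor>x $ i\<rfloor>) :: real ^ 'm"
  show "?g \<in> integer_lattice" by (simp add: integer_lattice_def)
  have "dist x ?g \<le> (\<Sum>i\<in>UNIV. \<bar>(x - ?g) $ i\<bar>)"
    unfolding dist_norm by (rule norm_le_l1_cart)
  also have "\<dots> \<le> (\<Sum>i\<in>(UNIV :: 'm set). 1)"
  proof (rule sum_mono)
    fix i show "\<bar>(x - ?g) $ i\<bar> \<le> 1"
      by simp linarith
  qed
  finally show "dist x ?g \<le> real CARD('m)" by simp
qed

theorem theorem6p2:
  fixes G :: "(real ^ 'm) set" and f u :: "real ^ 'm \<Rightarrow> real"
  assumes "G = integer_lattice \<or> closure G = UNIV"
    and "multi_almost_automorphic G f"
    and "bounded (range f)"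
    and "continuous_on UNIV u"
    and "bounded (range u)"
    and "distributional_poisson_solution u f"
  shows "compact_almost_automorphic u"
proof -
  have "\<exists>R. \<forall>x. \<exists>g\<in>G. dist x g \<le> R"
    using assms(1)
  proof
    assume "G = integer_lattice"
    then show ?thesis using integer_lattice_relatively_dense by blast
  next
    assume "closure G = UNIV"
    then have "\<exists>g\<in>G. dist x g \<le> 1" for x
      using closure_approachable[of x G] by (metis UNIV_I dist_commute less_imp_le zero_less_one)
    then show ?thesis by blast
  qed
  then obtain R where "\<And>x. \<exists>g\<in>G. dist x g \<le> R" by blast
  moreover obtain N where "\<And>x. \<bar>f x\<bar> \<le> N"
    using assms(3) by (auto simp: bounded_iff)
  moreover obtain M where "\<And>x. \<bar>u x\<bar> \<le> M"
    using assms(5) by (auto simp: bounded_iff)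
  ultimately show ?thesis
    using poisson_compact_almost_automorphic assms(2,4,6) by blast
qed

end
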